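(* Let $p>0$ be fixed. Let $c_0$ denote the unique real number (with $1+\frac{1-c_0}{p}>0$) satisfying $$\left(1+\frac{1-c_0}{p}\right)^{1-p}-\frac{1-c_0}{p}=0.$$ (i) If $p>1$, then for every real $c$ with $c_0\le c<1$, every non-negative sequence $(\lambda_n)_{n\ge1}$ with $\lambda_1>0$, and every non-negative sequence $(x_n)_{n\ge1}$, $$\sum_{n=1}^{\infty}\lambda_n\Lambda_n^{-c}\left(\sum_{k=n}^{\infty}\lambda_kx_k\right)^p\le\left(\frac{p}{1-c}\right)^p\sum_{n=1}^{\infty}\lambda_n\Lambda_n^{p-c}x_n^p,$$ where $\Lambda_n=\sum_{i=1}^n\lambda_i$. (ii) If $p>1$, then for every real $c$ with $c_0\le c<1$, every non-negative sequence $(\lambda_n)_{n\ge1}$ with $\lambda_1>0$ and $\sum_{n=1}^\infty\lambda_n<\infty$, and every non-negative sequence $(x_n)_{n\ge1}$, $$\sum_{n=1}^{\infty}\lambda_n(\Lambda_n^* )^{-c}\left(\sum_{k=1}^{n}\lambda_kx_k\right)^p\le\left(\frac{p}{1-c}\right)^p\sum_{n=1}^{\infty}\lambda_n(\Lambda_n^* )^{p-c}x_n^p,$$ where $\Lambda_n^*=\sum_{k=n}^\infty\lambda_k$. (iii) If $0<p<1$, then for every real $c<c_0$, every non-negative sequence $(\lambda_n)_{n\ge1}$ with $\lambda_1>0$, and every non-negative sequence $(x_n)_{n\ge1}$, $$\sum_{n=1}^{\infty}\lambda_n\Lambda_n^{-c}\left(\sum_{k=n}^{\infty}\lambda_kx_k\right)^p\ge\left(\frac{p}{1-c}\right)^p\sum_{n=1}^{\infty}\lambda_n\Lambda_n^{p-c}x_n^p,$$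 where $\Lambda_n=\sum_{i=1}^n\lambda_i$.
   Context: All sequences are real. Sums of non-negative terms are taken in $[0,\infty]$. Any term of an outer sum with $\lambda_n=0$ is read as $0$ (this matters only when $\Lambda_n^*=0$, in which case $\lambda_n=0$). *)

theory Defs
  imports "HOL-Analysis.Analysis"
begin

text \<open>
  Sequences \<open>(a\<^sub>n)\<close> with \<open>n \<ge> 1\<close> are functions \<open>nat \<Rightarrow> real\<close>; the value at \<open>0\<close> is
  never used.
\<close>

definition is_c0 :: "real \<Rightarrow> real \<Rightarrow> bool" where
  "is_c0 p c \<longleftrightarrow>
     1 + (1 - c) / p > 0 \<and> (1 + (1 - c) / p) powr (1 - p) - (1 - c) / p = 0"

definition c0 :: "real \<Rightarrow> real" where
  "c0 p = (THE c. is_c0 p c)"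

text \<open>Real powers on \<open>[0,\<infinity>]\<close>, with \<open>\<infinity> powr p = \<infinity>\<close>; only meant for exponents \<open>p > 0\<close>.\<close>

definition ennreal_powr :: "ennreal \<Rightarrow> real \<Rightarrow> ennreal" where
  "ennreal_powr a p = (if a = \<infinity> then \<infinity> else ennreal (enn2real a powr p))"

definition Lam :: "(nat \<Rightarrow> real) \<Rightarrow> nat \<Rightarrow> real" where
  "Lam l n = (\<Sum>i=1..n. l i)"

text \<open>
  For non-negative summable \<open>l\<close>, \<open>Lam_star l n = 0\<close> forces \<open>l n = 0\<close>, so that a term
  \<open>l n * Lam_star l n powr a * \<dots>\<close> is then \<open>0\<close>, whatever the sign of \<open>a\<close>.
\<close>

definition Lam_star :: "(nat \<Rightarrow> real) \<Rightarrow> nat \<Rightarrow> real" where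
  "Lam_star l n = (\<Sum>\<^sub>\<infinity>k\<in>{n..}. l k)"

end

theory Submission
  imports Defs
begin

text \<open>
  Put \<open>t = (1 - c) / p\<close>. The function \<open>t * (1 + t) powr (p - 1)\<close> is strictly increasing for
  \<open>t > 0\<close> and equals \<open>1\<close> exactly at \<open>c = c\<^sub>0\<close>. The inequality for \<open>x\<close> truncated at \<open>N\<close> telescopes
  with the correction terms \<open>\<Lambda>\<^sub>n powr (p * t) / t * S powr p\<close>, where \<open>S\<close> is the inner sum started
  at \<open>n + 1\<close>. With \<open>h = \<lambda>\<^sub>n / \<Lambda>\<^sub>n\<close>, the convexity (for \<open>p < 1\<close> concavity) of \<open>u powr p\<close> reduces a
  single step to \<open>t * h + (1 - h) powr (p * t) \<le> (1 + h * t) powr (1 - p)\<close> for \<open>0 \<le> h \<le> 1\<close>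
  (\<open>\<ge>\<close> if \<open>p < 1\<close>). This is an equality at \<open>h = 0\<close>, and at \<open>h = 1\<close> it is precisely the condition
  on \<open>c\<close>. In between, either Bernoulli's inequality suffices, or the difference of the two sides
  first moves away from \<open>0\<close> in the right direction and then possibly turns back, once: the
  logarithms of the positive and negative part of its derivative differ by a convex (concave)
  function that vanishes at \<open>h = 0\<close>. For (ii) the same step is summed in the opposite direction.
\<close>

section \<open>The constant \<open>c0\<close> and the condition on
  \<open>(1 - c) / p\<close>\<close>

text \<open>The derivative factors as \<open>(1 + x) powr (p - 2) * (1 + p * x)\<close>, which is
  positive for every \<open>p > 0\<close>, also when the power itself decreases.\<close>

lemma mult_one_plus_powr_strict_mono:
  fixes p s t :: real
  assumes "p > 0" "0 < s" "s < t"
  shows "s * (1 + s) powr (p - 1) < t * (1 + t) powr (p - 1)"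
proof (rule DERIV_pos_imp_increasing[OF \<open>s < t\<close>])
  fix x assume "s \<le> x" "x \<le> t"
  then have x: "x > 0" using assms by simp
  have "((\<lambda>u. u * (1 + u) powr (p - 1)) has_real_derivative (1 + x) powr (p - 2) * (1 + p * x)) (at x)"
  proof -
    have "(1 + x) powr (p - 1) = (1 + x) * (1 + x) powr (p - 2)"
      using powr_mult_base[of "1 + x" "p - 2"] x by (simp add: algebra_simps)
    then show ?thesis
      using x by (auto intro!: derivative_eq_intros simp: algebra_simps)
  qed
  moreover have "(1 + x) powr (p - 2) * (1 + p * x) > 0"
    using x assms by (intro mult_pos_pos) (auto intro: add_pos_pos)
  ultimately show "\<exists>y. ((\<lambda>u. u * (1 + u) powr (p - 1)) has_real_derivative y) (at x) \<and> y > 0"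
    by blast
qed

text \<open>With \<open>t = (1 - c) / p\<close> the defining equation says
  \<open>t = (1 + t) powr (1 - p)\<close>. Its right side is positive, so \<open>t > 0\<close>, and
  multiplying by \<open>(1 + t) powr (p - 1)\<close> gives the form in which monotonicity
  applies.\<close>

lemma is_c0_iff:
  assumes "p > 0"
  shows "is_c0 p c \<longleftrightarrow> (1 - c) / p > 0 \<and> (1 - c) / p * (1 + (1 - c) / p) powr (p - 1) = 1"
proof -
  define t where "t = (1 - c) / p"
  have "1 + t > 0 \<and> (1 + t) powr (1 - p) - t = 0 \<longleftrightarrow> t > 0 \<and> t * (1 + t) powr (p - 1) = 1"
  proof (cases "1 + t > 0")
    case True
    then have pos: "(1 + t) powr (1 - p) > 0" and inv: "(1 + t) powr (p - 1) = 1 / (1 + t) powr (1 - p)"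
      using powr_minus_divide[of "1 + t" "1 - p"] by simp_all
    have "t * (1 + t) powr (p - 1) = 1 \<longleftrightarrow> t = (1 + t) powr (1 - p)"
      using pos by (auto simp: inv)
    then show ?thesis
      using True pos by (metis eq_iff_diff_eq_0)
  qed auto
  then show ?thesis
    by (simp add: is_c0_def t_def)
qed

lemma ex1_c0:
  assumes "p > 0"
  shows "\<exists>!c. is_c0 p c"
proof -
  \<comment> \<open>The upper end \<open>T - 1\<close> for the intermediate value theorem:
    \<open>T powr p = 2 * 2 powr p\<close>, and \<open>T \<ge> 2\<close> gives
    \<open>T / 2 \<le> T - 1\<close>, so the value there is at least
    \<open>2 powr p \<ge> 1\<close>. At \<open>0\<close> the function is \<open>0\<close>.\<close>
  define T where "T = (2::real) powr (1 + 1 / p)"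
  have T: "T \<ge> 2"
    using powr_mono[of 1 "1 + 1 / p" 2] assms by (simp add: T_def)
  have "1 \<le> (2::real) powr p"
    using assms by (simp add: ge_one_powr_ge_zero)
  also have "(2::real) powr p = T powr p / 2"
    using assms powr_add[of 2 p 1] unfolding T_def powr_powr by (simp add: distrib_right)
  also have "\<dots> = T / 2 * T powr (p - 1)"
    using powr_mult_base[of T "p - 1"] T by simp
  also have "\<dots> \<le> (T - 1) * T powr (p - 1)"
    using T by (intro mult_right_mono) auto
  finally have up: "1 \<le> (T - 1) * (1 + (T - 1)) powr (p - 1)"
    by simp
  have "\<exists>t\<ge>0. t \<le> T - 1 \<and> t * (1 + t) powr (p - 1) = 1"
    using T up by (intro IVT') (auto intro!: continuous_intros)
  then obtain t where t: "t \<ge> 0" "t * (1 + t) powr (p - 1) = 1"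
    by blast
  then have "t > 0"
    by (cases "t = 0") auto
  show ?thesis
  proof (rule ex1I)
    show "is_c0 p (1 - p * t)"
      using t \<open>t > 0\<close> assms by (simp add: is_c0_iff)
    fix c assume "is_c0 p c"
    then have c: "(1 - c) / p > 0" "(1 - c) / p * (1 + (1 - c) / p) powr (p - 1) = 1"
      using assms by (simp_all add: is_c0_iff)
    have "(1 - c) / p = t"
      using mult_one_plus_powr_strict_mono[OF assms c(1), of t]
        mult_one_plus_powr_strict_mono[OF assms \<open>t > 0\<close>, of "(1 - c) / p"] c t
      by linarith
    then show "c = 1 - p * t"
      using assms by (simp add: field_simps)
  qed
qed

lemma is_c0_c0: "p > 0 \<Longrightarrow> is_c0 p (c0 p)"
  unfolding c0_def by (rule theI'[OF ex1_c0])

text \<open>\<open>(1 - c) / p\<close> decreases in \<open>c\<close>, so it stays below its value at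
  \<open>c0 p\<close>, where the monotone product is \<open>1\<close>. Moving the power to the other
  side gives the form that the kernel inequality needs at \<open>h = 1\<close>.\<close>

lemma c0_le_imp:
  assumes "p > 0" "c0 p \<le> c" "c < 1"
  shows "(1 - c) / p > 0" "(1 - c) / p \<le> (1 + (1 - c) / p) powr (1 - p)"
proof -
  define s t where "s = (1 - c) / p" and "t = (1 - c0 p) / p"
  have t: "t > 0" "t * (1 + t) powr (p - 1) = 1"
    using is_c0_c0[OF assms(1)] assms by (simp_all add: is_c0_iff t_def)
  show "(1 - c) / p > 0" using assms by simp
  then have s: "s > 0" by (simp add: s_def)
  have "s \<le> t"
    using assms by (simp add: s_def t_def divide_right_mono)
  then have "s * (1 + s) powr (p - 1) \<le> 1"
    using mult_one_plus_powr_strict_mono[OF assms(1) s, of t] t by (cases "s = t") auto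
  then have "s * (1 + s) powr (p - 1) * (1 + s) powr (1 - p) \<le> 1 * (1 + s) powr (1 - p)"
    by (intro mult_right_mono) auto
  then have "s \<le> (1 + s) powr (1 - p)"
    using s by (simp add: mult.assoc flip: powr_add)
  then show "(1 - c) / p \<le> (1 + (1 - c) / p) powr (1 - p)"
    by (simp add: s_def)
qed

lemma less_c0_imp:
  assumes "p > 0" "c < c0 p"
  shows "(1 - c) / p > 0" "(1 - c) / p \<ge> (1 + (1 - c) / p) powr (1 - p)"
proof -
  define s t where "s = (1 - c) / p" and "t = (1 - c0 p) / p"
  have t: "t > 0" "t * (1 + t) powr (p - 1) = 1"
    using is_c0_c0[OF assms(1)] assms by (simp_all add: is_c0_iff t_def)
  have "t < s"
    using assms by (simp add: s_def t_def divide_strict_right_mono)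
  then show s: "(1 - c) / p > 0" using t by (simp add: s_def)
  have "s * (1 + s) powr (p - 1) \<ge> 1"
    using mult_one_plus_powr_strict_mono[OF assms(1) t(1) \<open>t < s\<close>] t by simp
  then have "s * (1 + s) powr (p - 1) * (1 + s) powr (1 - p) \<ge> 1 * (1 + s) powr (1 - p)"
    by (intro mult_right_mono) auto
  then have "s \<ge> (1 + s) powr (1 - p)"
    using s by (simp add: mult.assoc s_def flip: powr_add)
  then show "(1 - c) / p \<ge> (1 + (1 - c) / p) powr (1 - p)"
    by (simp add: s_def)
qed

section \<open>Bernoulli's inequality and weighted power means\<close>

lemma powr_le_affine:
  fixes u p :: real
  assumes "u \<ge> 0" "0 \<le> p" "p \<le> 1"
  shows "u powr p \<le> 1 + p * (u - 1)"
proof (cases "u = 0")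
  case False
  then show ?thesis
    using Youngs_inequality_0[of p "1 - p" u 1] assms by (simp add: algebra_simps)
qed (use assms in simp)

text \<open>The concave case, applied to \<open>u powr p\<close> with exponent \<open>1 / p\<close>
  and solved for \<open>u powr p\<close>.\<close>

lemma powr_ge_affine:
  fixes u p :: real
  assumes "u \<ge> 0" "p \<ge> 1"
  shows "u powr p \<ge> 1 + p * (u - 1)"
proof -
  have "(u powr p) powr (1 / p) \<le> 1 + (1 / p) * (u powr p - 1)"
    using assms by (intro powr_le_affine) auto
  then show ?thesis
    using assms by (simp add: powr_powr field_simps)
qed

lemma powr_ge_affine_nonpos:
  fixes u p :: real
  assumes "u > 0" "p \<le> 0"
  shows "u powr p \<ge> 1 + p * (u - 1)"
proof -
  have "p * (u - 1) \<le> p * ln u"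
    using assms ln_le_minus_one[of u] by (intro mult_left_mono_neg) auto
  also have "1 + p * ln u \<le> exp (p * ln u)"
    by (rule exp_ge_add_one_self)
  finally show ?thesis
    using assms by (simp add: powr_def)
qed

text \<open>\<open>m\<close> is the mean of \<open>a\<close> and \<open>b / t\<close> with weights
  \<open>1\<close> and \<open>h * t\<close>. Dividing by \<open>m\<close> moves the power mean
  inequality to the tangent line at \<open>1\<close>, and the first identity makes the linear terms
  cancel.\<close>

lemma weighted_power_mean_aux:
  fixes p t h a b m :: real
  assumes "t > 0" "h \<ge> 0" "a \<ge> 0" "b \<ge> 0" and m: "m = (a + h * b) / (1 + h * t)" "m > 0"
  shows "(a / m - 1) + h * t * (b / (t * m) - 1) = 0"
    and "(1 + h * t) powr (1 - p) * (a + h * b) powr p = m powr p * (1 + h * t)"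
    and "a powr p + h * t * (b / t) powr p = m powr p * ((a / m) powr p + h * t * (b / (t * m)) powr p)"
proof -
  have ht: "1 + h * t > 0"
    using assms by (simp add: add_pos_nonneg)
  have mm: "a + h * b = m * (1 + h * t)"
    using ht m by simp
  have "(a / m - 1) + h * t * (b / (t * m) - 1) = (a + h * b) / m - (1 + h * t)"
    using assms(1) m(2) by (simp add: field_simps)
  then show "(a / m - 1) + h * t * (b / (t * m) - 1) = 0"
    using mm m(2) by simp
  show "(1 + h * t) powr (1 - p) * (a + h * b) powr p = m powr p * (1 + h * t)"
    using ht m(2) by (simp add: mm powr_mult powr_diff)
  show "a powr p + h * t * (b / t) powr p = m powr p * ((a / m) powr p + h * t * (b / (t * m)) powr p)"
    using assms(1-4) m(2) by (simp add: powr_mult powr_divide field_simps)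
qed

text \<open>Jensen's inequality for the convex function \<open>u powr p\<close>, proved by adding
  the tangent line bounds for \<open>a / m\<close> and \<open>b / (t * m)\<close>.\<close>

lemma weighted_power_mean_le:
  fixes p t h a b :: real
  assumes "p \<ge> 1" "t > 0" "h \<ge> 0" "a \<ge> 0" "b \<ge> 0"
  shows "(1 + h * t) powr (1 - p) * (a + h * b) powr p \<le> a powr p + h * t * (b / t) powr p"
proof (cases "a + h * b = 0")
  case True
  then show ?thesis using assms by simp
next
  case False
  define m where "m = (a + h * b) / (1 + h * t)"
  have "1 + h * t > 0"
    using assms by (simp add: add_pos_nonneg)
  moreover have "a + h * b > 0"
    using False assms by (simp add: order_less_le)
  ultimately have m: "m > 0"
    by (simp add: m_def)
  note aux = weighted_power_mean_aux[OF assms(2-5) m_def m]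
  have "1 + h * t = 1 + p * (a / m - 1) + h * t * (1 + p * (b / (t * m) - 1))"
  proof -
    have "1 + p * (a / m - 1) + h * t * (1 + p * (b / (t * m) - 1)) - (1 + h * t)
       = p * ((a / m - 1) + h * t * (b / (t * m) - 1))"
      by algebra
    then show ?thesis using aux(1) by simp
  qed
  also have "\<dots> \<le> (a / m) powr p + h * t * (b / (t * m)) powr p"
    using assms m by (intro add_mono mult_left_mono powr_ge_affine) auto
  finally show ?thesis
    unfolding aux(2,3) by (intro mult_left_mono) auto
qed

lemma weighted_power_mean_ge:
  fixes p t h a b :: real
  assumes "0 \<le> p" "p \<le> 1" "t > 0" "h \<ge> 0" "a \<ge> 0" "b \<ge> 0"
  shows "(1 + h * t) powr (1 - p) * (a + h * b) powr p \<ge> a powr p + h * t * (b / t) powr p"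
proof (cases "a + h * b = 0")
  case True
  then have "a = 0" "h * b = 0"
    using assms by (auto simp: add_nonneg_eq_0_iff)
  then show ?thesis by auto
next
  case False
  define m where "m = (a + h * b) / (1 + h * t)"
  have "1 + h * t > 0"
    using assms by (simp add: add_pos_nonneg)
  moreover have "a + h * b > 0"
    using False assms by (simp add: order_less_le)
  ultimately have m: "m > 0"
    by (simp add: m_def)
  note aux = weighted_power_mean_aux[OF assms(3-6) m_def m]
  have "(a / m) powr p + h * t * (b / (t * m)) powr p
      \<le> 1 + p * (a / m - 1) + h * t * (1 + p * (b / (t * m) - 1))"
    using assms m by (intro add_mono mult_left_mono powr_le_affine) auto
  also have "\<dots> = 1 + h * t"
  proof -
    have "1 + p * (a / m - 1) + h * t * (1 + p * (b / (t * m) - 1)) - (1 + h * t)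
       = p * ((a / m - 1) + h * t * (b / (t * m) - 1))"
      by algebra
    then show ?thesis using aux(1) by simp
  qed
  finally show ?thesis
    unfolding aux(2,3) by (intro mult_left_mono) auto
qed

section \<open>The kernel inequality in one variable\<close>

text \<open>If \<open>\<phi>\<close> were negative at \<open>h\<close>, it would have a negative
  derivative at some \<open>z < h\<close>, so \<open>g z > 0\<close>. As \<open>g\<close> is convex
  with \<open>g 0 \<le> 0\<close>, it stays positive to the right of \<open>z\<close>, so
  \<open>\<phi>\<close> cannot climb back to \<open>\<phi> 1 \<ge> 0\<close>. The interval for
  \<open>g\<close> omits \<open>1\<close> because \<open>g\<close> will contain
  \<open>ln (1 - h)\<close>.\<close>

lemma nonneg_if_derivative_sign_convex:
  fixes \<phi> \<phi>' g :: "real \<Rightarrow> real"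
  assumes cont: "continuous_on {0..1} \<phi>"
    and der: "\<And>h. 0 < h \<Longrightarrow> h < 1 \<Longrightarrow> (\<phi> has_real_derivative \<phi>' h) (at h)"
    and conv: "convex_on {0..<1} g"
    and sgn: "\<And>h. 0 < h \<Longrightarrow> h < 1 \<Longrightarrow> \<phi>' h < 0 \<longleftrightarrow> g h > 0"
    and "g 0 \<le> 0" "\<phi> 0 \<ge> 0" "\<phi> 1 \<ge> 0" "0 \<le> h" "h \<le> 1"
  shows "\<phi> h \<ge> 0"
proof (rule ccontr)
  assume neg: "\<not> \<phi> h \<ge> 0"
  then have h: "0 < h" "h < 1"
    using assms by (auto simp: order_less_le)
  obtain l z where z: "0 < z" "z < h" "(\<phi> has_real_derivative l) (at z)" "\<phi> h - \<phi> 0 = (h - 0) * l"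
  proof -
    have "continuous_on {0..h} \<phi>"
      using h by (intro continuous_on_subset[OF cont]) auto
    moreover have "\<phi> differentiable (at x)" if "0 < x" "x < h" for x
      using der[of x] that h by (auto simp: real_differentiable_def)
    ultimately show thesis
      using MVT[of 0 h \<phi>] h that by blast
  qed
  have "l = \<phi>' z"
    using DERIV_unique[OF z(3) der] z h by simp
  then have "h * \<phi>' z < 0"
    using z neg \<open>\<phi> 0 \<ge> 0\<close> by simp
  then have chi_z: "g z > 0"
    using sgn[of z] z h by (simp add: mult_less_0_iff)
  obtain l w where w: "h < w" "w < 1" "(\<phi> has_real_derivative l) (at w)" "\<phi> 1 - \<phi> h = (1 - h) * l"
  proof -
    have "continuous_on {h..1} \<phi>"
      using h by (intro continuous_on_subset[OF cont]) auto
    moreover have "\<phi> differentiable (at x)" if "h < x" "x < 1" for x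
      using der[of x] that h by (auto simp: real_differentiable_def)
    ultimately show thesis
      using MVT[of h 1 \<phi>] h that by blast
  qed
  have l: "l = \<phi>' w"
    using DERIV_unique[OF w(3) der] w h by simp
  \<comment> \<open>\<open>z\<close> is the convex combination of \<open>0\<close> and
    \<open>w\<close> with weight \<open>z / w\<close> on \<open>w\<close>.\<close>
  have "g z \<le> (1 - z / w) * g 0 + z / w * g w"
    using convex_onD[OF conv, of "z / w" 0 w] z w h by simp
  moreover have "(1 - z / w) * g 0 \<le> 0"
    using z w h \<open>g 0 \<le> 0\<close> by (intro mult_nonneg_nonpos) auto
  ultimately have "z / w * g w > 0"
    using chi_z by linarith
  then have "g w > 0"
    using z w by (simp add: zero_less_mult_iff zero_less_divide_iff)
  then have "\<phi>' w < 0"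
    using sgn[of w] w h by simp
  then have "\<phi> 1 < \<phi> h"
    using w(4) l h mult_pos_neg[of "1 - h" "\<phi>' w"] by simp
  then show False
    using neg \<open>\<phi> 1 \<ge> 0\<close> by simp
qed

text \<open>The derivative is grouped as a difference of two positive quantities, so that its sign
  can be read off from their logarithms.\<close>

lemma kernel_derivative:
  fixes p t h :: real
  assumes "0 < h" "h < 1" "t > 0"
  shows "((\<lambda>h. (1 + h * t) powr (1 - p) - t * h - (1 - h) powr (p * t)) has_real_derivative
      t * (p * (1 - h) powr (p * t - 1) - (1 + (p - 1) * (1 + h * t) powr (- p)))) (at h)"
  using assms by (auto intro!: derivative_eq_intros simp: algebra_simps add_pos_pos)

lemma kernel_derivative_sign:
  fixes p t h :: real
  assumes "0 < h" "h < 1" "t > 0" "p > 0"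
  defines "g \<equiv> ln (1 + (p - 1) * (1 + h * t) powr (- p)) - (p * t - 1) * ln (1 - h) - ln p"
  shows "p * (1 - h) powr (p * t - 1) < 1 + (p - 1) * (1 + h * t) powr (- p) \<longleftrightarrow> g > 0"
    and "1 + (p - 1) * (1 + h * t) powr (- p) < p * (1 - h) powr (p * t - 1) \<longleftrightarrow> g < 0"
proof -
  have P: "1 + (p - 1) * (1 + h * t) powr (- p) > 0"
  proof -
    have ht: "1 + h * t > 1"
      using assms by simp
    then have "(1 + h * t) powr p \<ge> 1"
      using assms by (intro ge_one_powr_ge_zero) auto
    then have "(1 + h * t) powr (- p) > 0" "(1 + h * t) powr (- p) \<le> 1"
      using ht by (auto simp: powr_minus_divide simp del: less_add_same_cancel1)
    \<comment> \<open>With \<open>v = (1 + h * t) powr (- p)\<close> in \<open>(0, 1]\<close>, the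
      quantity \<open>1 + (p - 1) * v\<close> equals \<open>(1 - v) + p * v\<close>; this covers
      \<open>p < 1\<close> as well.\<close>
    then have "(1 - (1 + h * t) powr (- p)) + p * (1 + h * t) powr (- p) > 0"
      using assms by (intro add_nonneg_pos) auto
    then show ?thesis by (simp add: algebra_simps)
  qed
  have Q: "p * (1 - h) powr (p * t - 1) > 0"
    using assms by simp
  have "ln (p * (1 - h) powr (p * t - 1)) = ln p + (p * t - 1) * ln (1 - h)"
    using assms by (simp add: ln_mult ln_powr)
  then have g: "g = ln (1 + (p - 1) * (1 + h * t) powr (- p)) - ln (p * (1 - h) powr (p * t - 1))"
    by (simp add: g_def)
  show "p * (1 - h) powr (p * t - 1) < 1 + (p - 1) * (1 + h * t) powr (- p) \<longleftrightarrow> g > 0"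
    using ln_less_cancel_iff[OF Q P] unfolding g by linarith
  show "1 + (p - 1) * (1 + h * t) powr (- p) < p * (1 - h) powr (p * t - 1) \<longleftrightarrow> g < 0"
    using ln_less_cancel_iff[OF P Q] unfolding g by linarith
qed

text \<open>Negative powers are cleared so that each fraction is visibly monotone in
  \<open>h\<close>. The point \<open>h = 0\<close> is included because convexity is needed on
  \<open>{0..<1}\<close>.\<close>

lemma kernel_log_gap_derivative:
  fixes p t h :: real
  assumes "0 \<le> h" "h < 1" "t > 0" "p > 0"
  shows "((\<lambda>h. ln (1 + (p - 1) * (1 + h * t) powr (- p)) - (p * t - 1) * ln (1 - h) - ln p)
      has_real_derivative
      (p * t - 1) / (1 - h) - p * (p - 1) * t / ((1 + h * t) * ((1 + h * t) powr p + (p - 1)))) (at h)"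
proof -
  have pos: "1 + h * t > 0" "(1 + h * t) powr p + (p - 1) > 0"
    using assms ge_one_powr_ge_zero[of "1 + h * t" p] by (simp_all add: add_pos_nonneg)
  have eq: "1 + (p - 1) * (1 + h * t) powr (- p) = ((1 + h * t) powr p + (p - 1)) / (1 + h * t) powr p"
    using pos(1) by (simp add: powr_minus_divide field_simps)
  have P: "1 + (p - 1) * (1 + h * t) powr (- p) > 0"
    unfolding eq using pos by simp
  have eq2: "(1 + h * t) powr (- p - 1) = 1 / ((1 + h * t) powr p * (1 + h * t))"
    using pos(1) by (simp add: powr_diff powr_minus_divide)
  have "((\<lambda>h. 1 + (p - 1) * (1 + h * t) powr (- p)) has_real_derivative
      (p - 1) * (- p * (1 + h * t) powr (- p - 1) * t)) (at h)"
    using pos(1) by (auto intro!: derivative_eq_intros)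
  then have d1: "((\<lambda>h. ln (1 + (p - 1) * (1 + h * t) powr (- p))) has_real_derivative
      1 / (1 + (p - 1) * (1 + h * t) powr (- p)) * ((p - 1) * (- p * (1 + h * t) powr (- p - 1) * t))) (at h)"
    by (intro DERIV_chain2[where f = ln] DERIV_ln_divide P)
  have d2: "((\<lambda>h. (p * t - 1) * ln (1 - h) + ln p) has_real_derivative - ((p * t - 1) / (1 - h))) (at h)"
    using assms by (auto intro!: derivative_eq_intros)
  have "((\<lambda>h. ln (1 + (p - 1) * (1 + h * t) powr (- p)) - (p * t - 1) * ln (1 - h) - ln p)
      has_real_derivative
      (p - 1) * (- p * (1 + h * t) powr (- p - 1) * t) / (1 + (p - 1) * (1 + h * t) powr (- p))
        + (p * t - 1) / (1 - h)) (at h)"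
    using DERIV_diff[OF d1 d2] by (simp add: diff_diff_eq)
  also have "(p - 1) * (- p * (1 + h * t) powr (- p - 1) * t) / (1 + (p - 1) * (1 + h * t) powr (- p))
        + (p * t - 1) / (1 - h)
    = (p * t - 1) / (1 - h) - p * (p - 1) * t / ((1 + h * t) * ((1 + h * t) powr p + (p - 1)))"
  proof -
    have "(p - 1) * (- p * (1 / (Y * y)) * t) / (Z / Y) = - (p * (p - 1) * t / (y * Z))"
      if "Y > 0" "y > 0" "Z > 0" for Y y Z :: real
      using that by (simp add: field_simps)
    then show ?thesis
      unfolding eq eq2 using pos by simp
  qed
  finally show ?thesis .
qed

lemma kernel_continuous_on:
  fixes p t :: real
  assumes "p > 0" "t > 0"
  shows "continuous_on {0..1} (\<lambda>h. (1 + h * t) powr (1 - p) - t * h - (1 - h) powr (p * t))"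
proof -
  have "1 + h * t \<noteq> 0" if "h \<ge> 0" for h
    using that assms by (metis add_nonneg_eq_0_iff mult_nonneg_nonneg order_less_imp_le zero_le_one zero_neq_one)
  then have "continuous_on {0..1} (\<lambda>h. (1 + h * t) powr (1 - p))"
    by (intro continuous_on_powr continuous_intros) auto
  \<comment> \<open>The base is \<open>0\<close> at \<open>h = 1\<close>; continuity there comes
    from the positive exponent.\<close>
  moreover have "continuous_on {0..1} (\<lambda>h. (1 - h) powr (p * t))"
    using assms by (intro continuous_on_powr' continuous_intros) auto
  ultimately show ?thesis
    by (intro continuous_on_diff continuous_on_mult continuous_on_const continuous_on_id)
qed

lemma kernel_le:
  fixes p t h :: real
  assumes p: "p > 1" and t: "t > 0" "t \<le> (1 + t) powr (1 - p)" and h: "0 \<le> h" "h \<le> 1"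
  shows "t * h + (1 - h) powr (p * t) \<le> (1 + h * t) powr (1 - p)"
proof (cases "p * t \<le> 1")
  case True
  \<comment> \<open>Both sides of the goal are separated by the line
    \<open>1 + (1 - p) * t * h\<close>.\<close>
  have "(1 - h) powr (p * t) \<le> 1 + p * t * ((1 - h) - 1)"
    using True assms by (intro powr_le_affine) auto
  moreover have "(1 + h * t) powr (1 - p) \<ge> 1 + (1 - p) * ((1 + h * t) - 1)"
    using assms by (intro powr_ge_affine_nonpos) (auto intro: add_pos_nonneg)
  ultimately show ?thesis by (simp add: algebra_simps)
next
  case False
  have "(1 + h * t) powr (1 - p) - t * h - (1 - h) powr (p * t) \<ge> 0"
  proof (rule nonneg_if_derivative_sign_convex
      [where \<phi> = "\<lambda>h. (1 + h * t) powr (1 - p) - t * h - (1 - h) powr (p * t)"])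
    show "continuous_on {0..1} (\<lambda>h. (1 + h * t) powr (1 - p) - t * h - (1 - h) powr (p * t))"
      using p t by (intro kernel_continuous_on) auto
    show "convex_on {0..<1} (\<lambda>h. ln (1 + (p - 1) * (1 + h * t) powr (- p)) - (p * t - 1) * ln (1 - h) - ln p)"
    proof (rule convex_on_realI)
      fix h k :: real assume hk: "h \<in> {0..<1}" "k \<in> {0..<1}" "h \<le> k"
      \<comment> \<open>The first fraction increases because \<open>p * t > 1\<close>, the
        subtracted one decreases because \<open>p > 1\<close>; hence the derivative of the
        logarithmic gap increases.\<close>
      have "(p * t - 1) / (1 - h) \<le> (p * t - 1) / (1 - k)"
        using False hk by (intro divide_left_mono) auto
      moreover have "p * (p - 1) * t / ((1 + k * t) * ((1 + k * t) powr p + (p - 1)))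
          \<le> p * (p - 1) * t / ((1 + h * t) * ((1 + h * t) powr p + (p - 1)))"
        using hk p t by (intro divide_left_mono mult_mono add_mono powr_mono2 mult_pos_pos)
          (auto intro: add_pos_nonneg add_nonneg_pos)
      ultimately show "(p * t - 1) / (1 - h) - p * (p - 1) * t / ((1 + h * t) * ((1 + h * t) powr p + (p - 1)))
        \<le> (p * t - 1) / (1 - k) - p * (p - 1) * t / ((1 + k * t) * ((1 + k * t) powr p + (p - 1)))"
        by linarith
    qed (use p t in \<open>auto intro!: kernel_log_gap_derivative\<close>)
    fix h :: real assume "0 < h" "h < 1"
    then show "t * (p * (1 - h) powr (p * t - 1) - (1 + (p - 1) * (1 + h * t) powr (- p))) < 0 \<longleftrightarrow>
      ln (1 + (p - 1) * (1 + h * t) powr (- p)) - (p * t - 1) * ln (1 - h) - ln p > 0"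
      using kernel_derivative_sign(1)[of h t p] p t by (simp add: mult_less_0_iff)
  \<comment> \<open>At \<open>h = 0\<close> the gap is \<open>ln p - ln p\<close> and the difference
    of the sides is \<open>1 - 1\<close>. At \<open>h = 1\<close> the term
    \<open>0 powr (p * t)\<close> vanishes, which leaves the assumed bound on
    \<open>t\<close>.\<close>
  qed (use p t h in \<open>auto intro!: kernel_derivative\<close>)
  then show ?thesis by linarith
qed

text \<open>The mirror image of \<open>kernel_le\<close>: the tangent line bounds settle
  \<open>p * t \<ge> 1\<close>, and otherwise the sign criterion is applied to the negated
  difference and the negated logarithmic gap.\<close>

lemma kernel_ge:
  fixes p t h :: real
  assumes p: "0 < p" "p < 1" and t: "t > 0" "t \<ge> (1 + t) powr (1 - p)" and h: "0 \<le> h" "h \<le> 1"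
  shows "t * h + (1 - h) powr (p * t) \<ge> (1 + h * t) powr (1 - p)"
proof (cases "p * t \<ge> 1")
  case True
  have "(1 - h) powr (p * t) \<ge> 1 + p * t * ((1 - h) - 1)"
    using True assms by (intro powr_ge_affine) auto
  moreover have "(1 + h * t) powr (1 - p) \<le> 1 + (1 - p) * ((1 + h * t) - 1)"
    using assms by (intro powr_le_affine) (auto intro: add_nonneg_nonneg)
  ultimately show ?thesis by (simp add: algebra_simps)
next
  case False
  have "- ((1 + h * t) powr (1 - p) - t * h - (1 - h) powr (p * t)) \<ge> 0"
  proof (rule nonneg_if_derivative_sign_convex
      [where \<phi> = "\<lambda>h. - ((1 + h * t) powr (1 - p) - t * h - (1 - h) powr (p * t))"])
    show "continuous_on {0..1} (\<lambda>h. - ((1 + h * t) powr (1 - p) - t * h - (1 - h) powr (p * t)))"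
      using p t by (intro continuous_on_minus kernel_continuous_on) auto
    show "convex_on {0..<1} (\<lambda>h. - (ln (1 + (p - 1) * (1 + h * t) powr (- p)) - (p * t - 1) * ln (1 - h) - ln p))"
    proof (rule convex_on_realI)
      fix h k :: real assume hk: "h \<in> {0..<1}" "k \<in> {0..<1}" "h \<le> k"
      have "(1 - p * t) / (1 - h) \<le> (1 - p * t) / (1 - k)"
        using False hk by (intro divide_left_mono) auto
      moreover have "p * (1 - p) * t / ((1 + k * t) * ((1 + k * t) powr p + (p - 1)))
          \<le> p * (1 - p) * t / ((1 + h * t) * ((1 + h * t) powr p + (p - 1)))"
      proof -
        \<comment> \<open>Since \<open>p - 1\<close> is negative here, this bound is what keeps the
          denominators positive.\<close>
        have "(1 + u * t) powr p \<ge> 1" if "u \<ge> 0" for u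
          using that p t by (intro ge_one_powr_ge_zero) auto
        from this[of h] this[of k] show ?thesis
          using hk p t by (intro divide_left_mono mult_mono add_mono powr_mono2 mult_pos_pos)
            (auto intro: add_pos_nonneg add_nonneg_pos)
      qed
      ultimately show "- ((p * t - 1) / (1 - h) - p * (p - 1) * t / ((1 + h * t) * ((1 + h * t) powr p + (p - 1))))
        \<le> - ((p * t - 1) / (1 - k) - p * (p - 1) * t / ((1 + k * t) * ((1 + k * t) powr p + (p - 1))))"
        by (simp add: algebra_simps diff_divide_distrib)
    qed (use p t in \<open>auto simp del: minus_diff_eq intro!: kernel_log_gap_derivative DERIV_minus\<close>)
    fix h :: real assume "0 < h" "h < 1"
    then show "- (t * (p * (1 - h) powr (p * t - 1) - (1 + (p - 1) * (1 + h * t) powr (- p)))) < 0 \<longleftrightarrow>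
      - (ln (1 + (p - 1) * (1 + h * t) powr (- p)) - (p * t - 1) * ln (1 - h) - ln p) > 0"
      using kernel_derivative_sign(2)[of h t p] p t by (simp add: zero_less_mult_iff)
  qed (use p t h in \<open>auto simp del: minus_diff_eq intro!: kernel_derivative DERIV_minus\<close>)
  then show ?thesis by linarith
qed

section \<open>A single step of the telescoping argument\<close>

text \<open>Substituting \<open>l = h * L\<close> and \<open>L0 = (1 - h) * L\<close> extracts the
  common factor \<open>L powr (p * t) / t\<close>. What remains is the kernel against the power mean
  of \<open>S\<close> and \<open>L * x / t\<close>.\<close>

lemma copson_step_scaled:
  fixes p t l L0 S x :: real
  assumes "t > 0" "l \<ge> 0" "L0 \<ge> 0" "L0 + l > 0" "x \<ge> 0" "S \<ge> 0"
  defines "L \<equiv> L0 + l" and "h \<equiv> l / (L0 + l)"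
  shows "l * L powr (p * t - 1) * (S + l * x) powr p + L0 powr (p * t) / t * (S + l * x) powr p
      = L powr (p * t) / t * ((t * h + (1 - h) powr (p * t)) * (S + h * (L * x)) powr p)"
    and "(1 / t) powr p * (l * L powr (p + p * t - 1) * x powr p) + L powr (p * t) / t * S powr p
      = L powr (p * t) / t * (S powr p + h * t * (L * x / t) powr p)"
proof -
  have L: "L > 0" "h * L = l" "(1 - h) * L = L0" "1 - h \<ge> 0"
    using assms by (auto simp: L_def h_def field_simps)
  have L0: "L0 powr (p * t) = (1 - h) powr (p * t) * L powr (p * t)"
    using L(1,4) by (simp flip: L(3) add: powr_mult)
  have l: "l * L powr (p * t - 1) = h * L powr (p * t)"
    using L(1) by (simp flip: L(2) add: powr_diff)
  have l': "l * L powr (p + p * t - 1) = h * L powr (p * t) * L powr p"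
    using L(1) by (simp flip: L(2) add: powr_diff powr_add)
  have S: "S + h * (L * x) = S + l * x"
    using L(2) by (simp add: mult.assoc[symmetric])
  show "l * L powr (p * t - 1) * (S + l * x) powr p + L0 powr (p * t) / t * (S + l * x) powr p
      = L powr (p * t) / t * ((t * h + (1 - h) powr (p * t)) * (S + h * (L * x)) powr p)"
    unfolding L0 l S using \<open>t > 0\<close> by (simp add: field_simps)
  have "(L * x / t) powr p = (1 / t) powr p * L powr p * x powr p"
    using \<open>t > 0\<close> \<open>x \<ge> 0\<close> L(1) by (simp add: powr_mult powr_divide)
  then show "(1 / t) powr p * (l * L powr (p + p * t - 1) * x powr p) + L powr (p * t) / t * S powr p
      = L powr (p * t) / t * (S powr p + h * t * (L * x / t) powr p)"
    unfolding l' using \<open>t > 0\<close> by (simp add: field_simps)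
qed

lemma copson_step_le:
  fixes p t l L0 S x :: real
  assumes "p > 1" "t > 0" "t \<le> (1 + t) powr (1 - p)"
    and "l \<ge> 0" "L0 \<ge> 0" "x \<ge> 0" "S \<ge> 0"
  shows "l * (L0 + l) powr (p * t - 1) * (S + l * x) powr p + L0 powr (p * t) / t * (S + l * x) powr p
      \<le> (1 / t) powr p * (l * (L0 + l) powr (p + p * t - 1) * x powr p) + (L0 + l) powr (p * t) / t * S powr p"
proof (cases "L0 + l > 0")
  case True
  define h where "h = l / (L0 + l)"
  have h: "0 \<le> h" "h \<le> 1"
    using True assms by (auto simp: h_def)
  have "(t * h + (1 - h) powr (p * t)) * (S + h * ((L0 + l) * x)) powr p
      \<le> (1 + h * t) powr (1 - p) * (S + h * ((L0 + l) * x)) powr p"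
    using kernel_le[OF assms(1-3) h] by (intro mult_right_mono) auto
  also have "\<dots> \<le> S powr p + h * t * ((L0 + l) * x / t) powr p"
    using assms h by (intro weighted_power_mean_le) auto
  finally show ?thesis
    unfolding copson_step_scaled[OF assms(2,4,5) True assms(6,7)] h_def[symmetric]
    using assms by (intro mult_left_mono) auto
next
  \<comment> \<open>Here both weights vanish, and \<open>0 powr a = 0\<close> for every
    \<open>a\<close> makes each term \<open>0\<close>. This covers tail sums
    \<open>Lam_star l n\<close> equal to \<open>0\<close>.\<close>
  case False
  then have "l = 0" "L0 = 0" using assms by auto
  then show ?thesis by simp
qed

lemma copson_step_ge:
  fixes p t l L0 S x :: real
  assumes "0 < p" "p < 1" "t > 0" "t \<ge> (1 + t) powr (1 - p)"
    and "l \<ge> 0" "L0 \<ge> 0" "x \<ge> 0" "S \<ge> 0"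
  shows "l * (L0 + l) powr (p * t - 1) * (S + l * x) powr p + L0 powr (p * t) / t * (S + l * x) powr p
      \<ge> (1 / t) powr p * (l * (L0 + l) powr (p + p * t - 1) * x powr p) + (L0 + l) powr (p * t) / t * S powr p"
proof (cases "L0 + l > 0")
  case True
  define h where "h = l / (L0 + l)"
  have h: "0 \<le> h" "h \<le> 1"
    using True assms by (auto simp: h_def)
  have "S powr p + h * t * ((L0 + l) * x / t) powr p
      \<le> (1 + h * t) powr (1 - p) * (S + h * ((L0 + l) * x)) powr p"
    using assms h by (intro weighted_power_mean_ge) auto
  also have "\<dots> \<le> (t * h + (1 - h) powr (p * t)) * (S + h * ((L0 + l) * x)) powr p"
    using kernel_ge[OF assms(1-4) h] by (intro mult_right_mono) auto
  finally show ?thesis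
    unfolding copson_step_scaled[OF assms(3,5,6) True assms(7,8)] h_def[symmetric]
    using assms by (intro mult_left_mono) auto
next
  case False
  then have "l = 0" "L0 = 0" using assms by auto
  then show ?thesis by simp
qed

section \<open>Sums and powers in the extended non-negative reals\<close>

lemma sum_le_infsum_ennreal:
  fixes f :: "'a \<Rightarrow> ennreal"
  assumes "finite F" "F \<subseteq> A"
  shows "sum f F \<le> infsum f A"
proof -
  have "infsum f F \<le> infsum f A"
    by (rule infsum_mono_neutral) (use assms in \<open>auto simp: nonneg_summable_on_complete\<close>)
  then show ?thesis using assms by simp
qed

text \<open>Unordered sums are limits over finite subsets; the intervals \<open>{n..N}\<close>
  eventually contain each finite subset of \<open>{n..}\<close>.\<close>

lemma tendsto_infsum_atLeast_ennreal:
  fixes f :: "nat \<Rightarrow> ennreal"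
  shows "(\<lambda>N. sum f {n..N}) \<longlonglongrightarrow> infsum f {n..}"
proof -
  have "(f has_sum infsum f {n..}) {n..}"
    by (simp add: nonneg_summable_on_complete)
  moreover have "filterlim (\<lambda>N. {n..N}) (finite_subsets_at_top {n..}) sequentially"
    unfolding filterlim_finite_subsets_at_top
  proof (intro allI impI)
    fix X :: "nat set" assume X: "finite X \<and> X \<subseteq> {n..}"
    then have "X \<subseteq> {n..N}" if "N \<ge> Max X" for N
      using that by (auto intro: order_trans[OF Max_ge])
    then show "\<forall>\<^sub>F N in sequentially. finite {n..N} \<and> X \<subseteq> {n..N} \<and> {n..N} \<subseteq> {n..}"
      by (auto intro!: eventually_sequentiallyI[of "Max X"])
  qed
  ultimately show ?thesis
    unfolding has_sum_def by (rule filterlim_compose)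
qed

lemma infsum_le_sum_ennreal:
  fixes f :: "nat \<Rightarrow> ennreal"
  assumes "\<And>N. sum f {n..N} \<le> b"
  shows "infsum f {n..} \<le> b"
  using tendsto_infsum_atLeast_ennreal[of f n] by (rule LIMSEQ_le_const2) (use assms in auto)

text \<open>Lets inner sums pass to the limit even when they diverge. A finite limit reduces to real
  powers, with \<open>p > 0\<close> covering the base \<open>0\<close>.\<close>

lemma tendsto_ennreal_powr:
  assumes "p > 0" "(f \<longlongrightarrow> a) F"
  shows "((\<lambda>x. ennreal_powr (f x) p) \<longlongrightarrow> ennreal_powr a p) F"
proof (cases "a = \<infinity>")
  case False
  then have fin: "a < top" by (simp add: less_top)
  have "eventually (\<lambda>x. f x < top) F"
    using order_tendstoD(2)[OF assms(2) fin] .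
  then have ev: "eventually (\<lambda>x. ennreal (enn2real (f x) powr p) = ennreal_powr (f x) p) F"
    by eventually_elim (auto simp: ennreal_powr_def)
  have "((\<lambda>x. enn2real (f x)) \<longlongrightarrow> enn2real a) F"
    using assms(2) fin by (intro tendsto_enn2real) auto
  then have "((\<lambda>x. ennreal (enn2real (f x) powr p)) \<longlongrightarrow> ennreal (enn2real a powr p)) F"
    using assms(1) by (intro tendsto_ennrealI tendsto_powr2) auto
  then have "((\<lambda>x. ennreal_powr (f x) p) \<longlongrightarrow> ennreal (enn2real a powr p)) F"
    using ev by (rule Lim_transform_eventually)
  then show ?thesis
    using False by (simp add: ennreal_powr_def)
next
  case True
  have "((\<lambda>x. ennreal_powr (f x) p) \<longlongrightarrow> top) F"
    unfolding tendsto_top_iff_ennreal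
  proof (intro allI impI)
    fix l :: real assume "0 \<le> l"
    \<comment> \<open>The threshold is chosen so that its \<open>p\<close>-th power is
      \<open>l\<close>.\<close>
    have "eventually (\<lambda>x. ennreal (l powr (1 / p)) < f x) F"
      using assms(2) True by (auto simp: tendsto_top_iff_ennreal)
    then show "eventually (\<lambda>x. ennreal l < ennreal_powr (f x) p) F"
    proof eventually_elim
      case (elim x)
      show ?case
      proof (cases "f x = \<infinity>")
        case False
        then obtain r where r: "r \<ge> 0" "f x = ennreal r"
          by (cases "f x") auto
        then have "l powr (1 / p) < r"
          using elim by (simp add: ennreal_less_iff)
        then have "(l powr (1 / p)) powr p < r powr p"
          using assms(1) by (intro powr_less_mono2) auto
        then show ?thesis
          using r assms(1) \<open>0 \<le> l\<close> by (simp add: ennreal_powr_def powr_powr ennreal_less_iff)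
      qed (simp add: ennreal_powr_def)
    qed
  qed
  then show ?thesis
    using True by (simp add: ennreal_powr_def)
qed

lemma ennreal_powr_mono:
  assumes "p > 0" "a \<le> b"
  shows "ennreal_powr a p \<le> ennreal_powr b p"
  using assms by (cases a; cases b)
    (auto simp: ennreal_powr_def top_unique intro!: ennreal_leI powr_mono2)

section \<open>Telescoping the finite inequalities\<close>

lemma sum_telescope_le:
  fixes A B D :: "nat \<Rightarrow> real"
  assumes "\<And>n. 1 \<le> n \<Longrightarrow> n \<le> N \<Longrightarrow> A n + D (n - 1) \<le> B n + D n"
  shows "sum A {1..N} + D 0 \<le> sum B {1..N} + D N"
  using assms
proof (induction N)
  case (Suc N)
  have "sum A {1..N} + D 0 \<le> sum B {1..N} + D N"
    using Suc.prems by (intro Suc.IH) auto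
  moreover have "A (Suc N) + D N \<le> B (Suc N) + D (Suc N)"
    using Suc.prems[of "Suc N"] by simp
  ultimately show ?case by simp
qed simp

lemma Lam_split: "n \<ge> 1 \<Longrightarrow> Lam l n = Lam l (n - 1) + l n"
  by (cases n) (simp_all add: Lam_def)

lemma Lam_nonneg: "(\<And>n. n \<ge> 1 \<Longrightarrow> l n \<ge> 0) \<Longrightarrow> Lam l n \<ge> 0"
  unfolding Lam_def by (intro sum_nonneg) auto

lemma Lam_star_split:
  assumes "l summable_on {1..}" "n \<ge> 1"
  shows "Lam_star l n = Lam_star l (Suc n) + l n"
proof -
  have "l summable_on {Suc n..}"
    using assms(1) by (rule summable_on_subset_banach) auto
  moreover have "{n..} = insert n {Suc n..}" by auto
  ultimately show ?thesis
    by (simp add: Lam_star_def infsum_insert)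
qed

lemma Lam_star_nonneg: "(\<And>n. n \<ge> 1 \<Longrightarrow> l n \<ge> 0) \<Longrightarrow> n \<ge> 1 \<Longrightarrow> Lam_star l n \<ge> 0"
  unfolding Lam_star_def by (intro infsum_nonneg) auto

lemma tail_sum_split:
  fixes f :: "nat \<Rightarrow> real"
  shows "n \<le> N \<Longrightarrow> (\<Sum>k=n..N. f k) = (\<Sum>k=Suc n..N. f k) + f n"
  by (simp add: sum.atLeast_Suc_atMost)

lemma copson_partial_le:
  fixes l x :: "nat \<Rightarrow> real"
  assumes p: "p > 1" and t: "t > 0" "t \<le> (1 + t) powr (1 - p)"
    and nonneg: "\<And>n. n \<ge> 1 \<Longrightarrow> l n \<ge> 0" "\<And>n. n \<ge> 1 \<Longrightarrow> x n \<ge> 0"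
  shows "(\<Sum>n=1..N. l n * Lam l n powr (p * t - 1) * (\<Sum>k=n..N. l k * x k) powr p)
      \<le> (1 / t) powr p * (\<Sum>n=1..N. l n * Lam l n powr (p + p * t - 1) * x n powr p)"
proof -
  define D where "D = (\<lambda>n. Lam l n powr (p * t) / t * (\<Sum>k=Suc n..N. l k * x k) powr p)"
  have "(\<Sum>n=1..N. l n * Lam l n powr (p * t - 1) * (\<Sum>k=n..N. l k * x k) powr p) + D 0
      \<le> (\<Sum>n=1..N. (1 / t) powr p * (l n * Lam l n powr (p + p * t - 1) * x n powr p)) + D N"
  proof (rule sum_telescope_le)
    fix n assume n: "1 \<le> n" "n \<le> N"
    have "(\<Sum>k=Suc n..N. l k * x k) \<ge> 0"
      using nonneg by (intro sum_nonneg) auto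
    then show "l n * Lam l n powr (p * t - 1) * (\<Sum>k=n..N. l k * x k) powr p + D (n - 1)
      \<le> (1 / t) powr p * (l n * Lam l n powr (p + p * t - 1) * x n powr p) + D n"
      using copson_step_le[OF p t, of "l n" "Lam l (n - 1)" "x n" "\<Sum>k=Suc n..N. l k * x k"] n nonneg
        Lam_nonneg[of l "n - 1"]
      by (simp add: D_def tail_sum_split[of n N] Lam_split[of n])
  qed
  \<comment> \<open>\<open>Lam l 0\<close> is an empty sum, and so is the inner sum started at
    \<open>N + 1\<close>.\<close>
  moreover have "D 0 = 0" "D N = 0"
    by (simp_all add: D_def Lam_def)
  ultimately show ?thesis
    by (simp add: sum_distrib_left)
qed

lemma copson_partial_ge:
  fixes l x :: "nat \<Rightarrow> real"
  assumes p: "0 < p" "p < 1" and t: "t > 0" "t \<ge> (1 + t) powr (1 - p)"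
    and nonneg: "\<And>n. n \<ge> 1 \<Longrightarrow> l n \<ge> 0" "\<And>n. n \<ge> 1 \<Longrightarrow> x n \<ge> 0"
  shows "(1 / t) powr p * (\<Sum>n=1..N. l n * Lam l n powr (p + p * t - 1) * x n powr p)
      \<le> (\<Sum>n=1..N. l n * Lam l n powr (p * t - 1) * (\<Sum>k=n..N. l k * x k) powr p)"
proof -
  define D where "D = (\<lambda>n. - (Lam l n powr (p * t) / t * (\<Sum>k=Suc n..N. l k * x k) powr p))"
  have "(\<Sum>n=1..N. (1 / t) powr p * (l n * Lam l n powr (p + p * t - 1) * x n powr p)) + D 0
      \<le> (\<Sum>n=1..N. l n * Lam l n powr (p * t - 1) * (\<Sum>k=n..N. l k * x k) powr p) + D N"
  proof (rule sum_telescope_le)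
    fix n assume n: "1 \<le> n" "n \<le> N"
    have "(\<Sum>k=Suc n..N. l k * x k) \<ge> 0"
      using nonneg by (intro sum_nonneg) auto
    then show "(1 / t) powr p * (l n * Lam l n powr (p + p * t - 1) * x n powr p) + D (n - 1)
      \<le> l n * Lam l n powr (p * t - 1) * (\<Sum>k=n..N. l k * x k) powr p + D n"
      using copson_step_ge[OF p t, of "l n" "Lam l (n - 1)" "x n" "\<Sum>k=Suc n..N. l k * x k"] n nonneg
        Lam_nonneg[of l "n - 1"]
      by (simp add: D_def tail_sum_split[of n N] Lam_split[of n])
  qed
  moreover have "D 0 = 0" "D N = 0"
    by (simp_all add: D_def Lam_def)
  ultimately show ?thesis
    by (simp add: sum_distrib_left)
qed

lemma copson_star_partial_le:
  fixes l x :: "nat \<Rightarrow> real"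
  assumes p: "p > 1" and t: "t > 0" "t \<le> (1 + t) powr (1 - p)"
    and nonneg: "\<And>n. n \<ge> 1 \<Longrightarrow> l n \<ge> 0" "\<And>n. n \<ge> 1 \<Longrightarrow> x n \<ge> 0"
    and summable: "l summable_on {1..}"
  shows "(\<Sum>n=1..N. l n * Lam_star l n powr (p * t - 1) * (\<Sum>k=1..n. l k * x k) powr p)
      \<le> (1 / t) powr p * (\<Sum>n=1..N. l n * Lam_star l n powr (p + p * t - 1) * x n powr p)"
proof -
  \<comment> \<open>In the single step \<open>Lam_star l (Suc n)\<close> plays the role of
    \<open>L0\<close>, so the larger total weight now belongs to the index \<open>n - 1\<close>;
    this reverses the direction and the sign of the correction terms.\<close>
  define D where "D = (\<lambda>n. - (Lam_star l (Suc n) powr (p * t) / t * (\<Sum>k=1..n. l k * x k) powr p))"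
  have "(\<Sum>n=1..N. l n * Lam_star l n powr (p * t - 1) * (\<Sum>k=1..n. l k * x k) powr p) + D 0
      \<le> (\<Sum>n=1..N. (1 / t) powr p * (l n * Lam_star l n powr (p + p * t - 1) * x n powr p)) + D N"
  proof (rule sum_telescope_le)
    fix n assume n: "1 \<le> n" "n \<le> N"
    have "(\<Sum>k=1..n - 1. l k * x k) \<ge> 0"
      using nonneg by (intro sum_nonneg) auto
    moreover have "(\<Sum>k=1..n. l k * x k) = (\<Sum>k=1..n - 1. l k * x k) + l n * x n"
      using n by (cases n) auto
    ultimately show "l n * Lam_star l n powr (p * t - 1) * (\<Sum>k=1..n. l k * x k) powr p + D (n - 1)
      \<le> (1 / t) powr p * (l n * Lam_star l n powr (p + p * t - 1) * x n powr p) + D n"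
      using copson_step_le[OF p t, of "l n" "Lam_star l (Suc n)" "x n" "\<Sum>k=1..n - 1. l k * x k"] n nonneg
        Lam_star_nonneg[of l "Suc n"]
      by (simp add: D_def Lam_star_split[OF summable, of n])
  qed
  \<comment> \<open>The last correction term need not vanish, but its sign is favourable on the
    right-hand side.\<close>
  moreover have "D 0 = 0" "D N \<le> 0"
    using t by (simp_all add: D_def)
  ultimately show ?thesis
    by (simp add: sum_distrib_left)
qed

section \<open>Passage to infinite sums\<close>

lemma sum_ennreal_powr:
  fixes a f :: "nat \<Rightarrow> real"
  assumes "\<And>n. n \<ge> 1 \<Longrightarrow> a n \<ge> 0" "\<And>n. n \<ge> 1 \<Longrightarrow> f n \<ge> 0"
  shows "(\<Sum>n=1..N. ennreal (a n) * ennreal_powr (\<Sum>k=n..N. ennreal (f k)) p)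
    = ennreal (\<Sum>n=1..N. a n * (\<Sum>k=n..N. f k) powr p)"
proof -
  have "ennreal (a n) * ennreal_powr (\<Sum>k=n..N. ennreal (f k)) p = ennreal (a n * (\<Sum>k=n..N. f k) powr p)"
    if "n \<ge> 1" for n
  proof -
    have "(\<Sum>k=n..N. ennreal (f k)) = ennreal (\<Sum>k=n..N. f k)" "(\<Sum>k=n..N. f k) \<ge> 0"
      using assms(2) that by (auto intro!: sum_ennreal sum_nonneg)
    then show ?thesis
      by (simp add: ennreal_powr_def ennreal_mult'')
  qed
  then have "(\<Sum>n=1..N. ennreal (a n) * ennreal_powr (\<Sum>k=n..N. ennreal (f k)) p)
    = (\<Sum>n=1..N. ennreal (a n * (\<Sum>k=n..N. f k) powr p))"
    by (intro sum.cong) auto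
  then show ?thesis
    using assms(1) by (subst (asm) sum_ennreal) auto
qed

lemma copson_le:
  fixes l x :: "nat \<Rightarrow> real"
  assumes p: "p > 1" and t: "t > 0" "t \<le> (1 + t) powr (1 - p)"
    and nonneg: "\<And>n. n \<ge> 1 \<Longrightarrow> l n \<ge> 0" "\<And>n. n \<ge> 1 \<Longrightarrow> x n \<ge> 0"
  shows "(\<Sum>\<^sub>\<infinity>n\<in>{1..}. ennreal (l n * Lam l n powr (p * t - 1)) *
            ennreal_powr (\<Sum>\<^sub>\<infinity>k\<in>{n..}. ennreal (l k * x k)) p)
      \<le> ennreal ((1 / t) powr p) *
        (\<Sum>\<^sub>\<infinity>n\<in>{1..}. ennreal (l n * Lam l n powr (p + p * t - 1) * x n powr p))" (is "_ \<le> ?R")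
proof (rule infsum_le_sum_ennreal)
  fix M :: nat
  \<comment> \<open>The outer range is frozen at \<open>M\<close> while the inner truncation
    \<open>N\<close> tends to infinity. For \<open>N \<ge> M\<close> the outer sum extends to
    \<open>N\<close>, where the finite inequality applies.\<close>
  have "(\<lambda>N. \<Sum>n=1..M. ennreal (l n * Lam l n powr (p * t - 1)) * ennreal_powr (\<Sum>k=n..N. ennreal (l k * x k)) p)
    \<longlonglongrightarrow> (\<Sum>n=1..M. ennreal (l n * Lam l n powr (p * t - 1)) *
            ennreal_powr (\<Sum>\<^sub>\<infinity>k\<in>{n..}. ennreal (l k * x k)) p)"
    using p by (intro tendsto_sum ennreal_tendsto_cmult tendsto_ennreal_powr tendsto_infsum_atLeast_ennreal) auto
  then show "(\<Sum>n=1..M. ennreal (l n * Lam l n powr (p * t - 1)) *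
            ennreal_powr (\<Sum>\<^sub>\<infinity>k\<in>{n..}. ennreal (l k * x k)) p) \<le> ?R"
  proof (rule LIMSEQ_le_const2, intro exI[of _ M] allI impI)
    fix N assume "M \<le> N"
    have "(\<Sum>n=1..M. ennreal (l n * Lam l n powr (p * t - 1)) * ennreal_powr (\<Sum>k=n..N. ennreal (l k * x k)) p)
       \<le> (\<Sum>n=1..N. ennreal (l n * Lam l n powr (p * t - 1)) * ennreal_powr (\<Sum>k=n..N. ennreal (l k * x k)) p)"
      using \<open>M \<le> N\<close> by (intro sum_mono2) auto
    also have "\<dots> = ennreal (\<Sum>n=1..N. l n * Lam l n powr (p * t - 1) * (\<Sum>k=n..N. l k * x k) powr p)"
      using nonneg by (subst sum_ennreal_powr) auto
    also have "\<dots> \<le> ennreal ((1 / t) powr p * (\<Sum>n=1..N. l n * Lam l n powr (p + p * t - 1) * x n powr p))"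
      by (intro ennreal_leI copson_partial_le assms)
    also have "\<dots> = ennreal ((1 / t) powr p) * (\<Sum>n=1..N. ennreal (l n * Lam l n powr (p + p * t - 1) * x n powr p))"
      using nonneg by (subst sum_ennreal) (auto simp: ennreal_mult')
    also have "\<dots> \<le> ?R"
      by (intro mult_left_mono sum_le_infsum_ennreal) auto
    finally show "(\<Sum>n=1..M. ennreal (l n * Lam l n powr (p * t - 1)) *
        ennreal_powr (\<Sum>k=n..N. ennreal (l k * x k)) p) \<le> ?R" .
  qed
qed

lemma copson_star_le:
  fixes l x :: "nat \<Rightarrow> real"
  assumes p: "p > 1" and t: "t > 0" "t \<le> (1 + t) powr (1 - p)"
    and nonneg: "\<And>n. n \<ge> 1 \<Longrightarrow> l n \<ge> 0" "\<And>n. n \<ge> 1 \<Longrightarrow> x n \<ge> 0"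
    and summable: "l summable_on {1..}"
  shows "(\<Sum>\<^sub>\<infinity>n\<in>{1..}. ennreal (l n * Lam_star l n powr (p * t - 1) * (\<Sum>k=1..n. l k * x k) powr p))
      \<le> ennreal ((1 / t) powr p) *
        (\<Sum>\<^sub>\<infinity>n\<in>{1..}. ennreal (l n * Lam_star l n powr (p + p * t - 1) * x n powr p))" (is "_ \<le> ?R")
proof (rule infsum_le_sum_ennreal)
  fix N :: nat
  have "(\<Sum>n=1..N. ennreal (l n * Lam_star l n powr (p * t - 1) * (\<Sum>k=1..n. l k * x k) powr p))
     = ennreal (\<Sum>n=1..N. l n * Lam_star l n powr (p * t - 1) * (\<Sum>k=1..n. l k * x k) powr p)"
    using nonneg by (subst sum_ennreal) auto
  also have "\<dots> \<le> ennreal ((1 / t) powr p * (\<Sum>n=1..N. l n * Lam_star l n powr (p + p * t - 1) * x n powr p))"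
    by (intro ennreal_leI copson_star_partial_le assms)
  also have "\<dots> = ennreal ((1 / t) powr p) * (\<Sum>n=1..N. ennreal (l n * Lam_star l n powr (p + p * t - 1) * x n powr p))"
    using nonneg by (subst sum_ennreal) (auto simp: ennreal_mult')
  also have "\<dots> \<le> ?R"
    by (intro mult_left_mono sum_le_infsum_ennreal) auto
  finally show "(\<Sum>n=1..N. ennreal (l n * Lam_star l n powr (p * t - 1) * (\<Sum>k=1..n. l k * x k) powr p)) \<le> ?R" .
qed

text \<open>One limit suffices here: in the finite inequality, completing the inner sums only
  enlarges the right-hand side.\<close>

lemma copson_ge:
  fixes l x :: "nat \<Rightarrow> real"
  assumes p: "0 < p" "p < 1" and t: "t > 0" "t \<ge> (1 + t) powr (1 - p)"
    and nonneg: "\<And>n. n \<ge> 1 \<Longrightarrow> l n \<ge> 0" "\<And>n. n \<ge> 1 \<Longrightarrow> x n \<ge> 0"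
  shows "ennreal ((1 / t) powr p) *
        (\<Sum>\<^sub>\<infinity>n\<in>{1..}. ennreal (l n * Lam l n powr (p + p * t - 1) * x n powr p))
      \<le> (\<Sum>\<^sub>\<infinity>n\<in>{1..}. ennreal (l n * Lam l n powr (p * t - 1)) *
            ennreal_powr (\<Sum>\<^sub>\<infinity>k\<in>{n..}. ennreal (l k * x k)) p)" (is "_ \<le> ?R")
proof (rule LIMSEQ_le_const2[OF ennreal_tendsto_cmult[OF _ tendsto_infsum_atLeast_ennreal]], simp,
    intro exI allI impI)
  fix N :: nat
  have "ennreal ((1 / t) powr p) * (\<Sum>n=1..N. ennreal (l n * Lam l n powr (p + p * t - 1) * x n powr p))
      = ennreal ((1 / t) powr p * (\<Sum>n=1..N. l n * Lam l n powr (p + p * t - 1) * x n powr p))"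
    using nonneg by (subst sum_ennreal) (auto simp: ennreal_mult')
  also have "\<dots> \<le> ennreal (\<Sum>n=1..N. l n * Lam l n powr (p * t - 1) * (\<Sum>k=n..N. l k * x k) powr p)"
    by (intro ennreal_leI copson_partial_ge assms)
  also have "\<dots> = (\<Sum>n=1..N. ennreal (l n * Lam l n powr (p * t - 1)) * ennreal_powr (\<Sum>k=n..N. ennreal (l k * x k)) p)"
    using nonneg by (subst sum_ennreal_powr) auto
  also have "\<dots> \<le> (\<Sum>n=1..N. ennreal (l n * Lam l n powr (p * t - 1)) *
      ennreal_powr (\<Sum>\<^sub>\<infinity>k\<in>{n..}. ennreal (l k * x k)) p)"
    using p by (intro sum_mono mult_left_mono ennreal_powr_mono sum_le_infsum_ennreal) auto
  also have "\<dots> \<le> ?R"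
    by (intro sum_le_infsum_ennreal) auto
  finally show "ennreal ((1 / t) powr p) *
      (\<Sum>n=1..N. ennreal (l n * Lam l n powr (p + p * t - 1) * x n powr p)) \<le> ?R" .
qed


theorem theorem2p1:
  fixes p :: real
  assumes p_pos: "p > 0"
  shows
    "(\<exists>!c. is_c0 p c) \<and>
     (p > 1 \<longrightarrow>
       (\<forall>(c::real) (l :: nat \<Rightarrow> real) (x :: nat \<Rightarrow> real).
          c0 p \<le> c \<longrightarrow> c < 1 \<longrightarrow>
          (\<forall>n\<ge>1. l n \<ge> 0) \<longrightarrow> l 1 > 0 \<longrightarrow> (\<forall>n\<ge>1. x n \<ge> 0) \<longrightarrow>
          (\<Sum>\<^sub>\<infinity>n\<in>{1..}. ennreal (l n * Lam l n powr (- c)) *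
              ennreal_powr (\<Sum>\<^sub>\<infinity>k\<in>{n..}. ennreal (l k * x k)) p)
          \<le> ennreal ((p / (1 - c)) powr p) *
            (\<Sum>\<^sub>\<infinity>n\<in>{1..}. ennreal (l n * Lam l n powr (p - c) * x n powr p)))) \<and>
     (p > 1 \<longrightarrow>
       (\<forall>(c::real) (l :: nat \<Rightarrow> real) (x :: nat \<Rightarrow> real).
          c0 p \<le> c \<longrightarrow> c < 1 \<longrightarrow>
          (\<forall>n\<ge>1. l n \<ge> 0) \<longrightarrow> l 1 > 0 \<longrightarrow> l summable_on {1..} \<longrightarrow>
          (\<forall>n\<ge>1. x n \<ge> 0) \<longrightarrow>
          (\<Sum>\<^sub>\<infinity>n\<in>{1..}. ennreal (l n * Lam_star l n powr (- c) *
              (\<Sum>k=1..n. l k * x k) powr p))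
          \<le> ennreal ((p / (1 - c)) powr p) *
            (\<Sum>\<^sub>\<infinity>n\<in>{1..}. ennreal (l n * Lam_star l n powr (p - c) * x n powr p)))) \<and>
     (p < 1 \<longrightarrow>
       (\<forall>(c::real) (l :: nat \<Rightarrow> real) (x :: nat \<Rightarrow> real).
          c < c0 p \<longrightarrow>
          (\<forall>n\<ge>1. l n \<ge> 0) \<longrightarrow> l 1 > 0 \<longrightarrow> (\<forall>n\<ge>1. x n \<ge> 0) \<longrightarrow>
          (\<Sum>\<^sub>\<infinity>n\<in>{1..}. ennreal (l n * Lam l n powr (- c)) *
              ennreal_powr (\<Sum>\<^sub>\<infinity>k\<in>{n..}. ennreal (l k * x k)) p)
          \<ge> ennreal ((p / (1 - c)) powr p) *
            (\<Sum>\<^sub>\<infinity>n\<in>{1..}. ennreal (l n * Lam l n powr (p - c) * x n powr p))))"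
proof (intro conjI impI allI)
  show "\<exists>!c. is_c0 p c"
    using p_pos by (rule ex1_c0)
next
  fix c :: real and l x :: "nat \<Rightarrow> real"
  assume "1 < p" "c0 p \<le> c" "c < 1" "\<forall>n\<ge>1. 0 \<le> l n" "\<forall>n\<ge>1. 0 \<le> x n"
  then show "(\<Sum>\<^sub>\<infinity>n\<in>{1..}. ennreal (l n * Lam l n powr (- c)) *
        ennreal_powr (\<Sum>\<^sub>\<infinity>k\<in>{n..}. ennreal (l k * x k)) p)
      \<le> ennreal ((p / (1 - c)) powr p) *
        (\<Sum>\<^sub>\<infinity>n\<in>{1..}. ennreal (l n * Lam l n powr (p - c) * x n powr p))"
    \<comment> \<open>With \<open>t = (1 - c) / p\<close> the exponents \<open>p * t - 1\<close> and
      \<open>p + p * t - 1\<close> become \<open>- c\<close> and \<open>p - c\<close>, and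
      \<open>1 / t\<close> becomes \<open>p / (1 - c)\<close>.\<close>
    using copson_le[OF _ c0_le_imp[OF p_pos], of c l x] p_pos by simp
next
  fix c :: real and l x :: "nat \<Rightarrow> real"
  assume "1 < p" "c0 p \<le> c" "c < 1" "\<forall>n\<ge>1. 0 \<le> l n" "l summable_on {1..}" "\<forall>n\<ge>1. 0 \<le> x n"
  then show "(\<Sum>\<^sub>\<infinity>n\<in>{1..}. ennreal (l n * Lam_star l n powr (- c) * (\<Sum>k=1..n. l k * x k) powr p))
      \<le> ennreal ((p / (1 - c)) powr p) *
        (\<Sum>\<^sub>\<infinity>n\<in>{1..}. ennreal (l n * Lam_star l n powr (p - c) * x n powr p))"
    using copson_star_le[OF _ c0_le_imp[OF p_pos], of c l x] p_pos by simp
next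
  fix c :: real and l x :: "nat \<Rightarrow> real"
  assume "p < 1" "c < c0 p" "\<forall>n\<ge>1. 0 \<le> l n" "\<forall>n\<ge>1. 0 \<le> x n"
  then show "ennreal ((p / (1 - c)) powr p) *
        (\<Sum>\<^sub>\<infinity>n\<in>{1..}. ennreal (l n * Lam l n powr (p - c) * x n powr p))
      \<le> (\<Sum>\<^sub>\<infinity>n\<in>{1..}. ennreal (l n * Lam l n powr (- c)) *
        ennreal_powr (\<Sum>\<^sub>\<infinity>k\<in>{n..}. ennreal (l k * x k)) p)"
    using copson_ge[OF p_pos _ less_c0_imp[OF p_pos], of c l x] p_pos by simp
qed

end
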